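(* Let $W$ be a well generated complex reflection group and $W_X\le W$ a parabolic subgroup. Then an element $g\in W_X$ is parabolic quasi-Coxeter in $W_X$ if and only if it is parabolic quasi-Coxeter in $W$.
   Context: A complex reflection group $W\le\mathrm{GL}(V)$ is a finite group generated by unitary reflections; its rank is $\operatorname{codim}(V^W)$. A good generating set of a reflection group $G$ is a set of $\operatorname{rank}(G)$ reflections generating $G$; $W$ is well generated if it has one. Parabolic subgroups are pointwise stabilizers of subsets of $V$ (parabolic subgroups of well generated groups are well generated). $\ell_R$ denotes reflection length; a reflection factorization is reduced if its length equals $\ell_R$ of its product (computed in the ambient group considered). An element $g$ of a well generated group $G$ is parabolic quasi-Coxeter in $G$ if some reduced reflection factorization of $g$ in $G$ has factors forming a good generating set of some parabolic subgroup of $G$. *)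

theory Defs
  imports "HOL-Analysis.Analysis"
begin

text \<open>V = complex^'n (a finite-dimensional complex inner product space with the standard
Hermitian form); linear maps of V are matrices complex^'n^'n acting by (*v).\<close>

definition mat_adj :: "complex^'n^'n \<Rightarrow> complex^'n^'n" where
  "mat_adj A = (\<chi> i j. cnj (A $ j $ i))"

definition unitary_mat :: "complex^'n^'n \<Rightarrow> bool" where
  "unitary_mat A \<longleftrightarrow> A ** mat_adj A = mat 1"

definition fixed_space :: "complex^'n^'n \<Rightarrow> (complex^'n) set" where
  "fixed_space g = {v. g *v v = v}"

text \<open>A unitary reflection: a non-identity unitary map of finite order fixing a
hyperplane pointwise (complex dimension measured by vec.dim).\<close>
definition is_reflection :: "complex^'n^'n \<Rightarrow> bool" where
  "is_reflection r \<longleftrightarrow> unitary_mat r \<and> r \<noteq> mat 1 \<and>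
     (\<exists>k>0. (((**) r) ^^ k) (mat 1) = mat 1) \<and>
     vec.dim (fixed_space r) = CARD('n) - 1"

text \<open>Subgroup of GL(V) generated by a set S of (invertible) matrices.\<close>
inductive_set gen :: "(complex^'n^'n) set \<Rightarrow> (complex^'n^'n) set" for S where
  gen_one: "mat 1 \<in> gen S"
| gen_step: "s \<in> S \<Longrightarrow> g \<in> gen S \<Longrightarrow> s ** g \<in> gen S"
| gen_step_inv: "s \<in> S \<Longrightarrow> g \<in> gen S \<Longrightarrow> matrix_inv s ** g \<in> gen S"

definition refls :: "(complex^'n^'n) set \<Rightarrow> (complex^'n^'n) set" where
  "refls G = {r \<in> G. is_reflection r}"

definition refl_group :: "(complex^'n^'n) set \<Rightarrow> bool" where
  "refl_group W \<longleftrightarrow> finite W \<and> (\<exists>R. (\<forall>r\<in>R. is_reflection r) \<and> W = gen R)"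

text \<open>V^G and rank(G) = codim V^G.\<close>
definition fix_set :: "(complex^'n^'n) set \<Rightarrow> (complex^'n) set" where
  "fix_set G = {v. \<forall>g\<in>G. g *v v = v}"

definition refl_rank :: "(complex^'n^'n) set \<Rightarrow> nat" where
  "refl_rank G = CARD('n) - vec.dim (fix_set G)"

definition good_gen_set :: "(complex^'n^'n) set \<Rightarrow> (complex^'n^'n) set \<Rightarrow> bool" where
  "good_gen_set G S \<longleftrightarrow> S \<subseteq> refls G \<and> card S = refl_rank G \<and> gen S = G"

definition well_generated :: "(complex^'n^'n) set \<Rightarrow> bool" where
  "well_generated W \<longleftrightarrow> refl_group W \<and> (\<exists>S. good_gen_set W S)"

text \<open>Parabolic subgroups: pointwise stabilizers in G of subsets of V.\<close>
definition parabolic :: "(complex^'n^'n) set \<Rightarrow> (complex^'n^'n) set \<Rightarrow> bool" where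
  "parabolic G P \<longleftrightarrow> (\<exists>A :: (complex^'n) set. P = {g \<in> G. \<forall>v\<in>A. g *v v = v})"

definition mprod :: "(complex^'n^'n) list \<Rightarrow> complex^'n^'n" where
  "mprod rs = foldr (**) rs (mat 1)"

definition refl_factorization :: "(complex^'n^'n) set \<Rightarrow> complex^'n^'n \<Rightarrow> (complex^'n^'n) list \<Rightarrow> bool" where
  "refl_factorization G g rs \<longleftrightarrow> set rs \<subseteq> refls G \<and> mprod rs = g"

text \<open>Reflection length of g in the ambient group G.\<close>
definition refl_length :: "(complex^'n^'n) set \<Rightarrow> complex^'n^'n \<Rightarrow> nat" where
  "refl_length G g = (LEAST k. \<exists>rs. refl_factorization G g rs \<and> length rs = k)"

definition reduced_refl_factorization :: "(complex^'n^'n) set \<Rightarrow> complex^'n^'n \<Rightarrow> (complex^'n^'n) list \<Rightarrow> bool" where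
  "reduced_refl_factorization G g rs \<longleftrightarrow> refl_factorization G g rs \<and> length rs = refl_length G g"

text \<open>g is parabolic quasi-Coxeter in G: some reduced reflection factorization (in G)
has (pairwise distinct) factors forming a good generating set of a parabolic subgroup of G.\<close>
definition parabolic_quasi_coxeter :: "(complex^'n^'n) set \<Rightarrow> complex^'n^'n \<Rightarrow> bool" where
  "parabolic_quasi_coxeter G g \<longleftrightarrow>
     (\<exists>rs P. reduced_refl_factorization G g rs \<and> distinct rs \<and>
             parabolic G P \<and> good_gen_set P (set rs))"

end

theory Submission
  imports Defs
begin

text \<open>If \<open>g = t\<^sub>1 \<cdots> t\<^sub>k\<close> is a product of reflections, then \<open>V\<^sup>g\<close> contains the intersection of the
fixed hyperplanes of the \<open>t\<^sub>i\<close>, so \<open>codim V\<^sup>g \<le> k\<close>; hence \<open>codim V\<^sup>g \<le> \<ell>\<^sub>R(g)\<close> in every reflection group.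
If the \<open>t\<^sub>i\<close> form a good generating set of a reflection group \<open>P\<close>, then \<open>k = codim V\<^sup>P\<close>, which
forces the roots of the \<open>t\<^sub>i\<close> to be linearly independent. As \<open>g v - v\<close> is a combination of these
roots whose coefficients vanish only if every \<open>t\<^sub>i\<close> fixes \<open>v\<close>, this gives \<open>V\<^sup>g = V\<^sup>P\<close>, so
\<open>k = codim V\<^sup>g\<close> and the factorization is reduced in any group containing the \<open>t\<^sub>i\<close>. Finally, parabolic
subgroups of \<open>W\<^sub>X\<close> are parabolic in \<open>W\<close>, and a parabolic subgroup \<open>P\<close> of \<open>W\<close> with \<open>V\<^sup>P = V\<^sup>g\<close> for some
\<open>g \<in> W\<^sub>X\<close> fixes the set defining \<open>W\<^sub>X\<close>, hence lies in \<open>W\<^sub>X\<close> and is parabolic there.\<close>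

definition herm :: "complex^'n \<Rightarrow> complex^'n \<Rightarrow> complex" where
  "herm x y = (\<Sum>i\<in>UNIV. x$i * cnj (y$i))"

lemma herm_add_left: "herm (x + y) z = herm x z + herm y z"
  by (simp add: herm_def distrib_right sum.distrib)

lemma herm_diff_left: "herm (x - y) z = herm x z - herm y z"
  by (simp add: herm_def left_diff_distrib sum_subtractf)

lemma herm_scale_left: "herm (c *s x) z = c * herm x z"
  by (simp add: herm_def sum_distrib_left mult_ac)

lemma herm_add_right: "herm z (x + y) = herm z x + herm z y"
  by (simp add: herm_def distrib_left sum.distrib)

lemma herm_diff_right: "herm z (x - y) = herm z x - herm z y"
  by (simp add: herm_def right_diff_distrib sum_subtractf)

lemma herm_scale_right: "herm z (c *s x) = cnj c * herm z x"
  by (simp add: herm_def sum_distrib_left mult_ac)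

lemma herm_zero_left [simp]: "herm 0 z = 0"
  by (simp add: herm_def)

lemma herm_zero_right [simp]: "herm z 0 = 0"
  by (simp add: herm_def)

lemma herm_self_eq_0: "herm x x = 0 \<longleftrightarrow> x = 0"
proof
  assume "herm x x = 0"
  moreover have "herm x x = complex_of_real (\<Sum>i\<in>UNIV. (cmod (x$i))\<^sup>2)"
    unfolding herm_def of_real_sum by (rule sum.cong) (simp_all add: complex_norm_square[symmetric])
  ultimately have "(\<Sum>i\<in>UNIV. (cmod (x$i))\<^sup>2) = 0"
    by (metis of_real_eq_0_iff)
  then show "x = 0"
    by (subst (asm) sum_nonneg_eq_0_iff) (auto simp: vec_eq_iff)
qed simp

lemma herm_mat_adj: "herm (A *v x) y = herm x (mat_adj A *v y)"
proof -
  have "herm (A *v x) y = (\<Sum>i\<in>UNIV. \<Sum>j\<in>UNIV. A$i$j * x$j * cnj (y$i))"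
    by (simp add: herm_def matrix_vector_mult_def sum_distrib_right)
  also have "\<dots> = (\<Sum>j\<in>UNIV. \<Sum>i\<in>UNIV. A$i$j * x$j * cnj (y$i))"
    by (rule sum.swap)
  also have "\<dots> = herm x (mat_adj A *v y)"
    by (simp add: herm_def mat_adj_def matrix_vector_mult_def sum_distrib_left mult_ac)
  finally show ?thesis .
qed

lemma herm_unitary: "unitary_mat A \<Longrightarrow> herm (A *v x) (A *v y) = herm x y"
  unfolding unitary_mat_def
  by (metis herm_mat_adj matrix_left_right_inverse matrix_vector_mul_assoc matrix_vector_mul_lid)

lemma subspace_herm_left_eq_0: "vec.subspace {x. herm x a = 0}"
  unfolding vec.subspace_def by (simp add: herm_add_left herm_scale_left)

lemma subspace_herm_right_eq_0: "vec.subspace {x. herm a x = 0}"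
  unfolding vec.subspace_def by (simp add: herm_add_right herm_scale_right)

lemma matrix_vector_mult_scale: "(A::complex^'n^'m) *v (c *s x) = c *s (A *v x)"
  by (simp add: matrix_vector_mult_def vec_eq_iff sum_distrib_left mult_ac)

lemma subspace_fix_set: "vec.subspace (fix_set T)"
  unfolding vec.subspace_def fix_set_def
  by (simp add: matrix_vector_right_distrib matrix_vector_mult_scale)

lemma fixed_space_eq_fix_set: "fixed_space t = fix_set {t}"
  by (simp add: fixed_space_def fix_set_def)

lemma dim_le_card: "vec.dim (S::(complex^'n) set) \<le> CARD('n)"
  by (metis top_greatest vec.dim_subset vec_dim_card)

lemma herm_fixed_space_orthogonal_image:
  assumes "unitary_mat s" "u \<in> fixed_space s"
  shows "herm u (s *v v - v) = 0"
  using assms herm_unitary[of s u v] by (simp add: fixed_space_def herm_diff_right)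

text \<open>By unitarity the image of \<open>s - 1\<close> is orthogonal to the hyperplane \<open>V\<^sup>s\<close>, hence a line
spanned by a root \<open>a\<close> with \<open>V\<^sup>s = a\<^sup>\<bottom>\<close>.\<close>

lemma reflection_root_exists:
  assumes "is_reflection (s::complex^'n^'n)"
  shows "\<exists>a. a \<noteq> 0 \<and> fixed_space s = {u. herm u a = 0} \<and> (\<forall>v. s *v v - v \<in> vec.span {a})"
proof -
  have unitary: "unitary_mat s" and "s \<noteq> mat 1"
    and dim_fixed: "vec.dim (fixed_space s) = CARD('n) - 1"
    using assms unfolding is_reflection_def by auto
  then obtain w where "s *v w \<noteq> w"
    using matrix_eq[of s "mat 1"] by auto
  define a where "a = s *v w - w"
  have "a \<noteq> 0"
    using \<open>s *v w \<noteq> w\<close> by (simp add: a_def)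
  define H where "H = {u. herm u a = 0}"
  have "vec.subspace H"
    unfolding H_def by (rule subspace_herm_left_eq_0)
  have "fixed_space s \<subseteq> H"
    unfolding H_def a_def using herm_fixed_space_orthogonal_image[OF unitary] by blast
  have "a \<notin> H"
    unfolding H_def using \<open>a \<noteq> 0\<close> herm_self_eq_0 by blast
  then have "vec.span H \<subset> vec.span UNIV"
    using \<open>vec.subspace H\<close> by (auto simp: vec.span_eq_iff[THEN iffD2])
  then have "vec.dim H < CARD('n)"
    by (metis vec.dim_psubset vec_dim_card)
  moreover have "vec.subspace (fixed_space s)"
    by (simp add: fixed_space_eq_fix_set subspace_fix_set)
  ultimately have fixed_eq: "fixed_space s = H"
    using vec.subspace_dim_equal[OF _ \<open>vec.subspace H\<close> \<open>fixed_space s \<subseteq> H\<close>] dim_fixed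
    by simp
  have "s *v v - v \<in> vec.span {a}" for v
  proof -
    define x where "x = s *v v - v"
    define y where "y = x - (herm x a / herm a a) *s a"
    have "herm a a \<noteq> 0"
      using \<open>a \<noteq> 0\<close> herm_self_eq_0 by blast
    then have "herm y a = 0"
      by (simp add: y_def herm_diff_left herm_scale_left)
    then have "herm y x = 0"
      using herm_fixed_space_orthogonal_image[OF unitary] fixed_eq by (simp add: H_def x_def)
    then have "herm y y = 0"
      using \<open>herm y a = 0\<close> by (simp add: y_def herm_diff_right herm_scale_right)
    then have "x = (herm x a / herm a a) *s a"
      by (simp add: herm_self_eq_0 y_def)
    then show ?thesis
      by (metis vec.span_base vec.span_scale insertI1 x_def)
  qed
  then show ?thesis
    using \<open>a \<noteq> 0\<close> fixed_eq H_def by blast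
qed

definition refl_root :: "complex^'n^'n \<Rightarrow> complex^'n" where
  "refl_root s = (SOME a. a \<noteq> 0 \<and> fixed_space s = {u. herm u a = 0} \<and> (\<forall>v. s *v v - v \<in> vec.span {a}))"

lemma
  assumes "is_reflection s"
  shows fixed_space_refl_root: "fixed_space s = {u. herm u (refl_root s) = 0}"
    and reflection_minus_id_in_span_refl_root: "s *v v - v \<in> vec.span {refl_root s}"
  using someI_ex[OF reflection_root_exists[OF assms]] unfolding refl_root_def by blast+

lemma mprod_minus_id_in_span_roots:
  assumes "\<forall>t\<in>set ts. is_reflection t"
  shows "mprod ts *v v - v \<in> vec.span (refl_root ` set ts)"
  using assms
proof (induction ts arbitrary: v)
  case Nil
  then show ?case by (simp add: mprod_def vec.span_zero)
next
  case (Cons t ts)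
  let ?h = "mprod ts"
  have "mprod (t # ts) *v v - v = (t *v (?h *v v) - ?h *v v) + (?h *v v - v)"
    by (simp add: mprod_def matrix_vector_mul_assoc[symmetric])
  moreover have "t *v (?h *v v) - ?h *v v \<in> vec.span (refl_root ` set (t # ts))"
    using Cons.prems reflection_minus_id_in_span_refl_root[of t]
      vec.span_mono[of "{refl_root t}" "refl_root ` set (t # ts)"] by auto
  moreover have "?h *v v - v \<in> vec.span (refl_root ` set (t # ts))"
    using Cons vec.span_mono[of "refl_root ` set ts" "refl_root ` set (t # ts)"] by auto
  ultimately show ?case
    by (metis vec.span_add)
qed

text \<open>Writing \<open>t\<^sub>1 \<cdots> t\<^sub>k v - v = (t\<^sub>1 w - w) + (w - v)\<close> with \<open>w = t\<^sub>2 \<cdots> t\<^sub>k v\<close>, the two summands lie in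
the spans of the first root and of the remaining roots, so both vanish.\<close>

lemma fixed_by_mprod_imp_fixed_by_factors:
  assumes "distinct ts" "\<forall>t\<in>set ts. is_reflection t" "inj_on refl_root (set ts)"
    "vec.independent (refl_root ` set ts)" "mprod ts *v v = v"
  shows "\<forall>t\<in>set ts. t *v v = v"
  using assms
proof (induction ts)
  case Nil
  then show ?case by simp
next
  case (Cons t ts)
  let ?h = "mprod ts"
  define x where "x = ?h *v v - v"
  have "t *v (?h *v v) = v"
    using Cons.prems(5) by (simp add: mprod_def matrix_vector_mul_assoc[symmetric])
  then have "- x \<in> vec.span {refl_root t}"
    using Cons.prems(2) reflection_minus_id_in_span_refl_root[of t "?h *v v"] by (simp add: x_def)
  then have "x \<in> vec.span {refl_root t}"
    using vec.span_neg by fastforce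
  then obtain c where c: "x = c *s refl_root t"
    by (auto simp: vec.span_singleton)
  have "refl_root t \<notin> refl_root ` set ts"
    using Cons.prems(1,3) by (auto simp: inj_on_def)
  then have root_t: "refl_root t \<notin> vec.span (refl_root ` set ts)"
    using Cons.prems(4) vec.independent_insert[of "refl_root t" "refl_root ` set ts"] by simp
  have "x \<in> vec.span (refl_root ` set ts)"
    using mprod_minus_id_in_span_roots[of ts v] Cons.prems(2) by (simp add: x_def)
  then have "c = 0"
    using root_t c vec.span_scale[of x _ "inverse c"] by (cases "c = 0") auto
  then have "?h *v v = v"
    using c by (simp add: x_def)
  moreover have "\<forall>t\<in>set ts. t *v v = v"
    using Cons.IH Cons.prems \<open>?h *v v = v\<close>
      vec.independent_mono[of "refl_root ` set (t # ts)" "refl_root ` set ts"]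
    by (auto simp: inj_on_def)
  ultimately show ?case
    using \<open>t *v (?h *v v) = v\<close> by simp
qed

lemma codim_fix_set_le_card:
  assumes "finite T" "\<forall>t\<in>T. is_reflection (t::complex^'n^'n)"
  shows "CARD('n) \<le> vec.dim (fix_set T) + card T"
  using assms
proof (induction T rule: finite_induct)
  case empty
  then show ?case
    by (simp add: fix_set_def vec_dim_card del: vec.dim_UNIV)
next
  case (insert t T)
  let ?F = "fixed_space t" and ?X = "fix_set T"
  have "fix_set (insert t T) = ?F \<inter> ?X"
    by (auto simp: fix_set_def fixed_space_def)
  moreover have "vec.dim {x + y |x y. x \<in> ?F \<and> y \<in> ?X} + vec.dim (?F \<inter> ?X)
      = vec.dim ?F + vec.dim ?X"
    by (rule vec.dim_sums_Int) (simp_all add: fixed_space_eq_fix_set subspace_fix_set)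
  moreover have "vec.dim ?F = CARD('n) - 1"
    using insert.prems unfolding is_reflection_def by simp
  moreover have "vec.dim {x + y |x y. x \<in> ?F \<and> y \<in> ?X} \<le> CARD('n)"
    by (rule dim_le_card)
  moreover have "CARD('n) \<le> vec.dim ?X + card T"
    using insert by simp
  ultimately show ?case
    using insert.hyps by simp
qed

lemma fix_set_subset_fixed_space_mprod: "fix_set (set ts) \<subseteq> fixed_space (mprod ts)"
proof
  fix v assume "v \<in> fix_set (set ts)"
  then show "v \<in> fixed_space (mprod ts)"
    by (induction ts) (auto simp: fix_set_def fixed_space_def mprod_def matrix_vector_mul_assoc[symmetric])
qed

lemma codim_fixed_space_mprod_le_length:
  assumes "\<forall>t\<in>set ts. is_reflection (t::complex^'n^'n)"
  shows "CARD('n) \<le> vec.dim (fixed_space (mprod ts)) + length ts"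
  using codim_fix_set_le_card[of "set ts"] assms card_length[of ts]
    vec.dim_subset[OF fix_set_subset_fixed_space_mprod[of ts]] by simp

lemma fix_set_gen:
  assumes "\<forall>s\<in>S. invertible (s::complex^'n^'n)"
  shows "fix_set (gen S) = fix_set S"
proof
  show "fix_set (gen S) \<subseteq> fix_set S"
    using gen.gen_step[OF _ gen.gen_one] by (auto simp: fix_set_def)
next
  show "fix_set S \<subseteq> fix_set (gen S)"
  proof (clarsimp simp: fix_set_def)
    fix v g assume v: "\<forall>s\<in>S. s *v v = v" and "g \<in> gen S"
    from \<open>g \<in> gen S\<close> show "g *v v = v"
    proof (induction g rule: gen.induct)
      case (gen_step_inv s g)
      have "invertible s"
        using assms gen_step_inv.hyps(1) by blast
      then have "matrix_inv s ** s = mat 1"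
        unfolding matrix_inv_def invertible_def by (rule someI2_ex) auto
      then have "matrix_inv s *v v = v"
        using gen_step_inv.hyps(1) v by (metis matrix_vector_mul_assoc matrix_vector_mul_lid)
      then show ?case
        using gen_step_inv by (simp add: matrix_vector_mul_assoc[symmetric])
    qed (use v in \<open>simp_all add: matrix_vector_mul_assoc[symmetric]\<close>)
  qed
qed

lemma reflection_invertible: "is_reflection s \<Longrightarrow> invertible s"
  unfolding is_reflection_def unitary_mat_def invertible_right_inverse by blast

lemma mprod_in_gen: "set rs \<subseteq> S \<Longrightarrow> mprod rs \<in> gen S"
  by (induction rs) (auto simp: mprod_def intro: gen.intros)

lemma not_inj_on_independent_imageE:
  assumes "\<not> (inj_on f S \<and> vec.independent (f ` S))"
  obtains s where "s \<in> S" "f s \<in> vec.span (f ` (S - {s}))"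
proof (cases "inj_on f S")
  case False
  then obtain s s' where "s \<in> S" "s' \<in> S" "s \<noteq> s'" "f s = f s'"
    by (auto simp: inj_on_def)
  then show ?thesis
    by (intro that[of s]) (auto intro: vec.span_base)
next
  case True
  then obtain a where "a \<in> f ` S" "a \<in> vec.span (f ` S - {a})"
    using assms unfolding vec.dependent_def by blast
  then obtain s where "s \<in> S" "a = f s" and "f ` S - {a} \<subseteq> f ` (S - {s})"
    by auto
  then show ?thesis
    using \<open>a \<in> vec.span (f ` S - {a})\<close> vec.span_mono by (intro that[of s]) auto
qed

lemma fix_set_subset_fixed_space_if_root_in_span:
  assumes "is_reflection s" "\<forall>t\<in>T. is_reflection t" "refl_root s \<in> vec.span (refl_root ` T)"
  shows "fix_set T \<subseteq> fixed_space s"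
proof
  fix v assume "v \<in> fix_set T"
  then have "refl_root ` T \<subseteq> {x. herm v x = 0}"
    using assms(2) fixed_space_refl_root by (auto simp: fix_set_def fixed_space_def)
  then have "herm v (refl_root s) = 0"
    using assms(3) vec.span_minimal[OF _ subspace_herm_right_eq_0] by blast
  then show "v \<in> fixed_space s"
    using assms(1) fixed_space_refl_root by blast
qed

text \<open>If a root were in the span of the others, dropping its reflection would not change the
fixed space, contradicting the codimension bound for the remaining reflections.\<close>

lemma independent_roots_if_codim_eq_card:
  assumes "finite S" "\<forall>s\<in>S. is_reflection (s::complex^'n^'n)"
    "vec.dim (fix_set S) + card S = CARD('n)"
  shows "inj_on refl_root S \<and> vec.independent (refl_root ` S)"
proof (rule ccontr)
  assume "\<not> ?thesis"
  then obtain s where s: "s \<in> S" "refl_root s \<in> vec.span (refl_root ` (S - {s}))"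
    by (rule not_inj_on_independent_imageE)
  have "fix_set (S - {s}) \<subseteq> fixed_space s"
    using fix_set_subset_fixed_space_if_root_in_span[OF _ _ s(2)] s(1) assms(2) by blast
  then have "fix_set (S - {s}) = fix_set S"
    using s(1) by (auto simp: fix_set_def fixed_space_def)
  moreover have "CARD('n) \<le> vec.dim (fix_set (S - {s})) + card (S - {s})"
    using codim_fix_set_le_card assms(1,2) by blast
  moreover have "card (S - {s}) < card S"
    using card_Diff1_less[OF assms(1) s(1)] .
  ultimately show False
    using assms(3) by simp
qed

lemma length_good_gen_set:
  fixes P :: "(complex^'n^'n) set"
  assumes "good_gen_set P (set rs)" "distinct rs"
  shows "length rs + vec.dim (fix_set P) = CARD('n)"
  using assms dim_le_card[of "fix_set P"] distinct_card[of rs]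
  by (simp add: good_gen_set_def refl_rank_def)

lemma fixed_space_mprod_good_gen_set:
  fixes P :: "(complex^'n^'n) set"
  assumes "good_gen_set P (set rs)" "distinct rs"
  shows "fixed_space (mprod rs) = fix_set P"
proof
  have refl: "\<forall>s\<in>set rs. is_reflection s" and gen_eq: "gen (set rs) = P"
    using assms(1) by (auto simp: good_gen_set_def refls_def)
  then have fix_eq: "fix_set P = fix_set (set rs)"
    using fix_set_gen reflection_invertible by metis
  then have "inj_on refl_root (set rs) \<and> vec.independent (refl_root ` set rs)"
    using independent_roots_if_codim_eq_card[of "set rs"] refl length_good_gen_set[OF assms]
      distinct_card[OF assms(2)] by simp
  then show "fixed_space (mprod rs) \<subseteq> fix_set P"
    using fixed_by_mprod_imp_fixed_by_factors[OF assms(2) refl] fix_eq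
    by (auto simp: fixed_space_def fix_set_def)
  show "fix_set P \<subseteq> fixed_space (mprod rs)"
    using mprod_in_gen[of rs "set rs"] gen_eq by (auto simp: fix_set_def fixed_space_def)
qed

lemma reduced_refl_factorization_good_gen_set:
  fixes P :: "(complex^'n^'n) set"
  assumes "good_gen_set P (set rs)" "distinct rs" "set rs \<subseteq> G"
  shows "reduced_refl_factorization G (mprod rs) rs"
proof -
  have fact: "refl_factorization G (mprod rs) rs"
    using assms by (auto simp: refl_factorization_def good_gen_set_def refls_def)
  have "length rs \<le> length ts" if "refl_factorization G (mprod rs) ts" for ts
  proof -
    have "\<forall>t\<in>set ts. is_reflection t" and "mprod ts = mprod rs"
      using that by (auto simp: refl_factorization_def refls_def)
    then show ?thesis
      using codim_fixed_space_mprod_le_length[of ts] fixed_space_mprod_good_gen_set[OF assms(1,2)]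
        length_good_gen_set[OF assms(1,2)] by simp
  qed
  then have "refl_length G (mprod rs) = length rs"
    unfolding refl_length_def using fact by (intro Least_equality) auto
  then show ?thesis
    using fact by (simp add: reduced_refl_factorization_def)
qed

lemma parabolic_quasi_coxeter_iff:
  "parabolic_quasi_coxeter G g \<longleftrightarrow>
    (\<exists>rs P. mprod rs = g \<and> set rs \<subseteq> G \<and> distinct rs \<and> parabolic G P \<and> good_gen_set P (set rs))"
  (is "_ \<longleftrightarrow> ?rhs")
proof
  assume "parabolic_quasi_coxeter G g"
  then obtain rs P where "reduced_refl_factorization G g rs" "distinct rs" "parabolic G P"
    "good_gen_set P (set rs)"
    unfolding parabolic_quasi_coxeter_def by blast
  then show ?rhs
    by (auto simp: reduced_refl_factorization_def refl_factorization_def refls_def)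
next
  assume ?rhs
  then obtain rs P where "mprod rs = g" "set rs \<subseteq> G" "distinct rs" "parabolic G P"
    "good_gen_set P (set rs)"
    by blast
  then show "parabolic_quasi_coxeter G g"
    unfolding parabolic_quasi_coxeter_def using reduced_refl_factorization_good_gen_set by blast
qed

lemma parabolic_subset: "parabolic G P \<Longrightarrow> P \<subseteq> G"
  by (auto simp: parabolic_def)

lemma parabolic_trans:
  assumes "parabolic W Q" "parabolic Q P"
  shows "parabolic W P"
proof -
  obtain A B where "Q = {h \<in> W. \<forall>v\<in>A. h *v v = v}" "P = {h \<in> Q. \<forall>v\<in>B. h *v v = v}"
    using assms by (auto simp: parabolic_def)
  then have "P = {h \<in> W. \<forall>v\<in>A \<union> B. h *v v = v}"
    by auto
  then show ?thesis
    unfolding parabolic_def by blast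
qed

lemma parabolic_restrict:
  assumes "parabolic W P" "P \<subseteq> Q" "Q \<subseteq> W"
  shows "parabolic Q P"
proof -
  obtain A where "P = {h \<in> W. \<forall>v\<in>A. h *v v = v}"
    using assms(1) by (auto simp: parabolic_def)
  then have "P = {h \<in> Q. \<forall>v\<in>A. h *v v = v}"
    using assms(2,3) by auto
  then show ?thesis
    unfolding parabolic_def by blast
qed

lemma subset_parabolic_if_fixes_fixed_space:
  assumes "parabolic W Q" "g \<in> Q" "P \<subseteq> W" "fixed_space g \<subseteq> fix_set P"
  shows "P \<subseteq> Q"
proof -
  obtain A where Q: "Q = {h \<in> W. \<forall>v\<in>A. h *v v = v}"
    using assms(1) by (auto simp: parabolic_def)
  then have "A \<subseteq> fix_set P"
    using assms(2,4) by (auto simp: fixed_space_def)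
  then show ?thesis
    using Q assms(3) by (auto simp: fix_set_def)
qed

theorem mainTheorem6:
  fixes W WX :: "(complex^'n^'n) set" and g :: "complex^'n^'n"
  assumes "well_generated W"
    and "parabolic W WX"
    and "g \<in> WX"
  shows "parabolic_quasi_coxeter WX g \<longleftrightarrow> parabolic_quasi_coxeter W g"
proof
  assume "parabolic_quasi_coxeter WX g"
  then obtain rs P where "mprod rs = g" "set rs \<subseteq> WX" "distinct rs" "parabolic WX P"
    "good_gen_set P (set rs)"
    unfolding parabolic_quasi_coxeter_iff by blast
  then show "parabolic_quasi_coxeter W g"
    unfolding parabolic_quasi_coxeter_iff
    using parabolic_subset[OF assms(2)] parabolic_trans[OF assms(2)] by blast
next
  assume "parabolic_quasi_coxeter W g"
  then obtain rs P where g: "mprod rs = g" and "distinct rs" "parabolic W P"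
    and good: "good_gen_set P (set rs)"
    unfolding parabolic_quasi_coxeter_iff by blast
  have "P \<subseteq> WX"
    using subset_parabolic_if_fixes_fixed_space[OF assms(2,3) parabolic_subset[OF \<open>parabolic W P\<close>]]
      fixed_space_mprod_good_gen_set[OF good \<open>distinct rs\<close>] g by blast
  moreover have "set rs \<subseteq> P"
    using good by (auto simp: good_gen_set_def refls_def)
  ultimately show "parabolic_quasi_coxeter WX g"
    unfolding parabolic_quasi_coxeter_iff
    using g \<open>distinct rs\<close> good parabolic_restrict[OF \<open>parabolic W P\<close> _ parabolic_subset[OF assms(2)]]
    by blast
qed

end
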